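(* Let $\alpha,\beta,\gamma,b,c,z\in\mathbb{C}$ and $p\ge 0$ with $\mathrm{Re}(\alpha)>0$ and $\mathrm{Re}(c)>\mathrm{Re}(b)>0$. Then $${}^{ML}\Phi_{p}(b;c;z)=\exp(z)\;{}^{ML}\Phi_{p}(c-b;c;-z).$$
   Context: The three-parameter Mittag-Leffler function is $E_{\alpha,\beta}^{\gamma}(z)=\sum_{n=0}^{\infty}\frac{(\gamma)_n}{\Gamma(\alpha n+\beta)}\frac{z^n}{n!}$ for $\alpha,\beta,\gamma\in\mathbb{C}$, $\mathrm{Re}(\alpha)>0$, where $(\gamma)_n=\gamma(\gamma+1)\cdots(\gamma+n-1)$, $(\gamma)_0=1$. The ML-generalized beta function is ${}^{ML}B_{p}(x,y)=\int_{0}^{1}t^{x-1}(1-t)^{y-1}E_{\alpha,\beta}^{\gamma}\left(-\frac{p}{t(1-t)}\right)dt$ for $\mathrm{Re}(x)>0$, $\mathrm{Re}(y)>0$ (the parameters $\alpha,\beta,\gamma$ are suppressed in the notation), and $B(x,y)=\int_0^1 t^{x-1}(1-t)^{y-1}dt$ is the classical beta function. The ML-generalized confluent hypergeometric function is ${}^{ML}\Phi_{p}(b;c;z)=\sum_{n=0}^{\infty}\frac{{}^{ML}B_{p}(b+n,c-b)}{B(b,c-b)}\frac{z^n}{n!}$ for $p\ge 0$, $\mathrm{Re}(c)>\mathrm{Re}(b)>0$, $\mathrm{Re}(\alpha)>0$.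
   Formalization: It is additionally assumed that the integral defining ML_B_p(b,c-b) exists; for p>0 it can diverge under the stated conditions (e.g. γ=-1, α=β=1, p=1, b=1/2, c=5/2), leaving the left-hand side undefined. *)

theory Defs
  imports "HOL-Analysis.Analysis"
begin

(* rGamma is the entire function 1/Gamma, so the terms for which alpha * n + beta is a
   pole of Gamma vanish, as is customary. *)
definition mittag_leffler3 :: "complex \<Rightarrow> complex \<Rightarrow> complex \<Rightarrow> complex \<Rightarrow> complex" where
  "mittag_leffler3 \<alpha> \<beta> \<gamma> z =
     (\<Sum>n. pochhammer \<gamma> n * rGamma (\<alpha> * of_nat n + \<beta>) * (z ^ n / fact n))"

(* The integrals below are Henstock-Kurzweil integrals. They extend the Lebesgue integral and
   the improper Riemann integral, and are 0 by convention where the integral does not exist. *)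

(* The classical beta function by Euler's integral for complex arguments; the library's Beta
   is the quotient Gamma x * Gamma y / Gamma (x + y). Meant for Re x > 0 and Re y > 0. *)
definition beta_integral :: "complex \<Rightarrow> complex \<Rightarrow> complex" where
  "beta_integral x y =
     integral {0..1} (\<lambda>t::real. of_real t powr (x - 1) * of_real (1 - t) powr (y - 1))"

definition beta_ML_integrand ::
  "complex \<Rightarrow> complex \<Rightarrow> complex \<Rightarrow> real \<Rightarrow> complex \<Rightarrow> complex \<Rightarrow> real \<Rightarrow> complex" where
  "beta_ML_integrand \<alpha> \<beta> \<gamma> p x y t =
     of_real t powr (x - 1) * of_real (1 - t) powr (y - 1) *
     mittag_leffler3 \<alpha> \<beta> \<gamma> (of_real (- p / (t * (1 - t))))"

(* For p > 0, positivity of Re x and Re y does not guarantee convergence. For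
   gamma = -1 the Mittag-Leffler factor is a polynomial of degree 1 in its argument, in general
   with nonzero leading coefficient, and the integrand then behaves like t powr (x - 2) at 0. *)
definition beta_ML ::
  "complex \<Rightarrow> complex \<Rightarrow> complex \<Rightarrow> real \<Rightarrow> complex \<Rightarrow> complex \<Rightarrow> complex" where
  "beta_ML \<alpha> \<beta> \<gamma> p x y = integral {0..1} (beta_ML_integrand \<alpha> \<beta> \<gamma> p x y)"

definition Phi_ML ::
  "complex \<Rightarrow> complex \<Rightarrow> complex \<Rightarrow> real \<Rightarrow> complex \<Rightarrow> complex \<Rightarrow> complex \<Rightarrow> complex" where
  "Phi_ML \<alpha> \<beta> \<gamma> p b c z =
     (\<Sum>n. beta_ML \<alpha> \<beta> \<gamma> p (b + of_nat n) (c - b) / beta_integral b (c - b) * (z ^ n / fact n))"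

end

theory Submission
  imports Defs
begin

text \<open>
  Write \<open>f\<close> for the integrand of the beta function at \<open>(b, c - b)\<close> and \<open>m n\<close> for its moment
  \<open>\<integral> t ^ n * f t\<close>. The reflection \<open>t \<mapsto> 1 - t\<close> turns the moments occurring on the right-hand side into
  \<open>\<integral> (1 - t) ^ n * f t\<close>, the binomial transform of \<open>m\<close>, and the binomial transform of a
  sequence corresponds to multiplying its exponential generating function by an exponential.
  Since \<open>f\<close> need not be absolutely integrable, the convergence of the generating function is
  obtained from the second mean value theorem, which bounds the moments uniformly in \<open>n\<close>.
\<close>

text \<open>The second mean value theorem reduces the integral of \<open>g * f\<close> to two values
  of \<open>g\<close> in [0,1] and two integrals of \<open>f\<close> over subintervals. The latter
  are bounded by continuity of the indefinite integral, so \<open>C\<close> depends on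
  \<open>f\<close> alone.\<close>

lemma bounded_integrals_mult_mono_real:
  fixes f :: "real \<Rightarrow> real"
  assumes f: "f integrable_on {a..b}" and "a \<le> b"
  obtains C where "\<And>g. \<lbrakk>mono_on {a..b} g; 0 \<le> g a; g b \<le> 1\<rbrakk> \<Longrightarrow>
    (\<lambda>x. g x * f x) integrable_on {a..b} \<and> \<bar>integral {a..b} (\<lambda>x. g x * f x)\<bar> \<le> C"
proof -
  have "continuous_on {a..b} (\<lambda>x. integral {x..b} f)"
    by (rule indefinite_integral_continuous_1'[OF f])
  then have "bounded ((\<lambda>x. integral {x..b} f) ` {a..b})"
    by (intro compact_imp_bounded compact_continuous_image) auto
  then obtain M where "\<forall>y \<in> (\<lambda>x. integral {x..b} f) ` {a..b}. norm y \<le> M"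
    unfolding bounded_iff by blast
  then have M: "\<bar>integral {x..b} f\<bar> \<le> M" if "x \<in> {a..b}" for x
    using that by auto
  show thesis
  proof
    fix g :: "real \<Rightarrow> real"
    assume g: "mono_on {a..b} g" "0 \<le> g a" "g b \<le> 1"
    have mono: "g x \<le> g y" if "a \<le> x" "x \<le> y" "y \<le> b" for x y
      using that by (intro mono_onD[OF g(1)]) auto
    obtain c where c: "c \<in> {a..b}" and
      I: "((\<lambda>x. g x * f x) has_integral (g a * integral {a..c} f + g b * integral {c..b} f)) {a..b}"
      by (rule second_mean_value_theorem_full[OF f \<open>a \<le> b\<close> mono])
    have gab: "g a \<le> g b" using mono \<open>a \<le> b\<close> by auto
    \<comment> \<open>\<open>M\<close> bounds only integrals that end at \<open>b\<close>; an
      initial piece is a difference of two of these.\<close>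
    have "integral {a..c} f = integral {a..b} f - integral {c..b} f"
      using Henstock_Kurzweil_Integration.integral_combine[OF _ _ f, of c] c by simp
    then have "\<bar>integral {a..c} f\<bar> \<le> 2 * M"
      using M[OF c] M[of a] \<open>a \<le> b\<close> by auto
    then have "\<bar>g a * integral {a..c} f\<bar> \<le> 1 * (2 * M)"
      using g gab unfolding abs_mult by (intro mult_mono) auto
    moreover have "\<bar>g b * integral {c..b} f\<bar> \<le> 1 * M"
      using g gab M[OF c] unfolding abs_mult by (intro mult_mono) auto
    ultimately have "\<bar>g a * integral {a..c} f + g b * integral {c..b} f\<bar> \<le> 3 * M"
      by linarith
    with I show "(\<lambda>x. g x * f x) integrable_on {a..b} \<and> \<bar>integral {a..b} (\<lambda>x. g x * f x)\<bar> \<le> 3 * M"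
      by (auto simp: has_integral_iff)
  qed
qed

text \<open>The real case applies to \<open>Re\<close> and \<open>Im\<close> separately. The
  intermediate points may differ, but only the bounds are needed, and these add up.\<close>

lemma bounded_integrals_mult_mono_complex:
  fixes f :: "real \<Rightarrow> complex"
  assumes f: "f integrable_on {a..b}" and "a \<le> b"
  obtains C where "\<And>g. \<lbrakk>mono_on {a..b} g; 0 \<le> g a; g b \<le> 1\<rbrakk> \<Longrightarrow>
    (\<lambda>x. of_real (g x) * f x) integrable_on {a..b} \<and>
    norm (integral {a..b} (\<lambda>x. of_real (g x) * f x)) \<le> C"
proof -
  have Re: "(\<lambda>x. Re (f x)) integrable_on {a..b}" and Im: "(\<lambda>x. Im (f x)) integrable_on {a..b}"
    using f has_integral_Re has_integral_Im unfolding integrable_on_def by blast+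
  from bounded_integrals_mult_mono_real[OF Re \<open>a \<le> b\<close>] obtain C where
    C: "\<And>g. \<lbrakk>mono_on {a..b} g; 0 \<le> g a; g b \<le> 1\<rbrakk> \<Longrightarrow>
      (\<lambda>x. g x * Re (f x)) integrable_on {a..b} \<and>
      \<bar>integral {a..b} (\<lambda>x. g x * Re (f x))\<bar> \<le> C" by blast
  from bounded_integrals_mult_mono_real[OF Im \<open>a \<le> b\<close>] obtain D where
    D: "\<And>g. \<lbrakk>mono_on {a..b} g; 0 \<le> g a; g b \<le> 1\<rbrakk> \<Longrightarrow>
      (\<lambda>x. g x * Im (f x)) integrable_on {a..b} \<and>
      \<bar>integral {a..b} (\<lambda>x. g x * Im (f x))\<bar> \<le> D" by blast
  show thesis
  proof
    fix g :: "real \<Rightarrow> real"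
    assume g: "mono_on {a..b} g" "0 \<le> g a" "g b \<le> 1"
    let ?h = "\<lambda>x. of_real (g x) * f x"
    have h: "?h integrable_on {a..b}"
      using C[OF g] D[OF g]
      by (subst integrable_componentwise_iff) (auto simp: Basis_complex_def)
    have "\<bar>Re (integral {a..b} ?h)\<bar> \<le> C"
      using C[OF g] integral_unique[OF has_integral_Re[OF integrable_integral[OF h]]] by simp
    moreover have "\<bar>Im (integral {a..b} ?h)\<bar> \<le> D"
      using D[OF g] integral_unique[OF has_integral_Im[OF integrable_integral[OF h]]] by simp
    ultimately show "?h integrable_on {a..b} \<and> norm (integral {a..b} ?h) \<le> C + D"
      using h cmod_le[of "integral {a..b} ?h"] by auto
  qed
qed

lemma bounded_moments:
  fixes f :: "real \<Rightarrow> complex"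
  assumes "f integrable_on {0..1}"
  obtains C where "\<And>n. (\<lambda>t. of_real t ^ n * f t) integrable_on {0..1}"
    and "\<And>n. norm (integral {0..1} (\<lambda>t. of_real t ^ n * f t)) \<le> C"
proof -
  obtain C where C: "\<And>g. \<lbrakk>mono_on {0..1} g; 0 \<le> g 0; g 1 \<le> 1\<rbrakk> \<Longrightarrow>
    (\<lambda>x. of_real (g x) * f x) integrable_on {0..1} \<and>
    norm (integral {0..1} (\<lambda>x. of_real (g x) * f x)) \<le> C"
    using bounded_integrals_mult_mono_complex[OF assms] by auto
  have "(\<lambda>t. of_real t ^ n * f t) integrable_on {0..1} \<and>
    norm (integral {0..1} (\<lambda>t. of_real t ^ n * f t)) \<le> C" for n
    \<comment> \<open>Every power is monotone on the unit interval with values in it, so one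
      \<open>C\<close> serves all \<open>n\<close>.\<close>
    using C[of "\<lambda>t. t ^ n"] by (simp add: mono_on_def power_mono)
  then show thesis using that by blast
qed

lemma integral_binomial_moment:
  fixes f :: "real \<Rightarrow> complex"
  assumes "\<And>n. (\<lambda>t. of_real t ^ n * f t) integrable_on S"
  shows "integral S (\<lambda>t. of_real (1 - t) ^ n * f t) =
    (\<Sum>k\<le>n. of_nat (n choose k) * (-1) ^ k * integral S (\<lambda>t. of_real t ^ k * f t))"
proof -
  have "of_real (1 - t) ^ n * f t =
      (\<Sum>k\<le>n. of_nat (n choose k) * (-1) ^ k * (of_real t ^ k * f t))" for t
  proof -
    have "of_real (1 - t) ^ n = (\<Sum>k\<le>n. of_nat (n choose k) * (- complex_of_real t) ^ k)"
      using binomial_ring[of "- complex_of_real t" 1 n] by simp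
    then show ?thesis
      by (simp add: sum_distrib_right power_minus[of "complex_of_real t"] mult.assoc)
  qed
  then have "integral S (\<lambda>t. of_real (1 - t) ^ n * f t) =
      integral S (\<lambda>t. \<Sum>k\<le>n. of_nat (n choose k) * (-1) ^ k * (of_real t ^ k * f t))"
    by simp
  also have "\<dots> = (\<Sum>k\<le>n. integral S (\<lambda>t. of_nat (n choose k) * (-1) ^ k * (of_real t ^ k * f t)))"
    by (intro integral_sum integrable_on_mult_right assms) auto
  finally show ?thesis by simp
qed

text \<open>Boundedness of \<open>m\<close> makes its generating function absolutely convergent, so
  it has a Cauchy product with the series of \<open>exp (- z)\<close>, whose coefficients are the
  binomial sums.\<close>

lemma egf_binomial_transform:
  fixes m :: "nat \<Rightarrow> complex"
  assumes m: "\<And>n. norm (m n) \<le> C"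
  shows "(\<Sum>n. m n * (z ^ n / fact n)) =
    exp z * (\<Sum>n. (\<Sum>k\<le>n. of_nat (n choose k) * (-1) ^ k * m k) * ((- z) ^ n / fact n))"
proof -
  have expand: "(\<lambda>n. w ^ n /\<^sub>R fact n) = (\<lambda>n. w ^ n / fact n)" for w :: complex
    by (auto simp: scaleR_conv_of_real field_simps)
  have sum_exp: "summable (\<lambda>n. norm (w ^ n / fact n))" for w :: complex
    using summable_norm_exp[of w] expand[of w] by metis
  have exp: "exp w = (\<Sum>n. w ^ n / fact n)" for w :: complex
    unfolding exp_def expand ..
  have "summable (\<lambda>n. norm (m n * (z ^ n / fact n)))"
  proof (rule summable_comparison_test')
    show "summable (\<lambda>n. C * norm (z ^ n / fact n))"
      by (intro summable_mult sum_exp)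
    show "norm (norm (m n * (z ^ n / fact n))) \<le> C * norm (z ^ n / fact n)" for n
      using mult_right_mono[OF m norm_ge_zero] by (simp only: norm_mult real_norm_def abs_mult abs_norm_cancel)
  qed
  from Cauchy_product[OF this sum_exp[of "- z"]]
  have "(\<Sum>n. m n * (z ^ n / fact n)) * exp (- z) =
      (\<Sum>n. \<Sum>i\<le>n. m i * (z ^ i / fact i) * ((- z) ^ (n - i) / fact (n - i)))"
    by (simp add: exp)
  also have "\<dots> = (\<Sum>n. (\<Sum>k\<le>n. of_nat (n choose k) * (-1) ^ k * m k) * ((- z) ^ n / fact n))"
  proof (intro suminf_cong, unfold sum_distrib_right, rule sum.cong[OF refl])
    fix n k :: nat
    assume "k \<in> {..n}"
    then have k: "k \<le> n" by simp
    \<comment> \<open>The sign \<open>(-1) ^ k\<close> of the transform turns the factor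
      \<open>(- z) ^ k\<close> back into \<open>z ^ k\<close>.\<close>
    have "(- z) ^ n = (- z) ^ k * (- z) ^ (n - k)"
      using k by (simp flip: power_add)
    then have "(-1) ^ k * (- z) ^ n = z ^ k * (- z) ^ (n - k)"
      by (simp add: power_minus[of z k])
    then show "m k * (z ^ k / fact k) * ((- z) ^ (n - k) / fact (n - k)) =
        of_nat (n choose k) * (-1) ^ k * m k * ((- z) ^ n / fact n)"
      using k by (simp add: binomial_fact field_simps)
  qed
  finally show ?thesis
    by (simp add: exp_minus field_simps)
qed

text \<open>Reflection at 0 followed by a shift by 1. Both preserve the default value 0, so
  \<open>f\<close> may be arbitrary.\<close>

lemma integral_reflect_unit_interval:
  fixes f :: "real \<Rightarrow> 'a::banach"
  shows "integral {0..1} (\<lambda>t. f (1 - t)) = integral {0..1} f"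
  using integral_shift_real_ivl[of 0 1 1 "\<lambda>t. f (1 - t)"]
    Henstock_Kurzweil_Integration.integral_reflect_real[of 1 0 f]
  by simp

lemma beta_integral_commute: "beta_integral x y = beta_integral y x"
  unfolding beta_integral_def
  by (subst integral_reflect_unit_interval[symmetric]) (simp add: mult.commute)

text \<open>The argument of the Mittag-Leffler factor involves only \<open>t * (1 - t)\<close>,
  which the reflection fixes.\<close>

lemma beta_ML_commute: "beta_ML \<alpha> \<beta> \<gamma> p x y = beta_ML \<alpha> \<beta> \<gamma> p y x"
  unfolding beta_ML_def beta_ML_integrand_def
  by (subst integral_reflect_unit_interval[symmetric]) (simp add: mult_ac)

lemma powr_add_of_nat_minus_one:
  fixes w x :: complex
  shows "w powr (x + of_nat n - 1) = w ^ n * w powr (x - 1)"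
proof (cases "w = 0")
  case False
  have "x + of_nat n - 1 = of_nat n + (x - 1)" by simp
  with False show ?thesis by (simp only: powr_add powr_nat' simp_thms)
\<comment> \<open>For \<open>w = 0\<close> both sides vanish because \<open>0 powr a = 0\<close> for
  every \<open>a\<close>.\<close>
qed simp

lemma beta_ML_integrand_add_of_nat_left:
  "beta_ML_integrand \<alpha> \<beta> \<gamma> p (x + of_nat n) y t =
    of_real t ^ n * beta_ML_integrand \<alpha> \<beta> \<gamma> p x y t"
  unfolding beta_ML_integrand_def powr_add_of_nat_minus_one by (simp only: mult.assoc mult.left_commute)

lemma beta_ML_integrand_add_of_nat_right:
  "beta_ML_integrand \<alpha> \<beta> \<gamma> p x (y + of_nat n) t =
    of_real (1 - t) ^ n * beta_ML_integrand \<alpha> \<beta> \<gamma> p x y t"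
  unfolding beta_ML_integrand_def powr_add_of_nat_minus_one by (simp only: mult.assoc mult.left_commute)

theorem theorem3p11:
  fixes \<alpha> \<beta> \<gamma> b c z :: complex and p :: real
  assumes "p \<ge> 0" and "Re \<alpha> > 0" and "Re c > Re b" and "Re b > 0"
    and "beta_ML_integrand \<alpha> \<beta> \<gamma> p b (c - b) integrable_on {0..1}"
  shows "Phi_ML \<alpha> \<beta> \<gamma> p b c z = exp z * Phi_ML \<alpha> \<beta> \<gamma> p (c - b) c (- z)"
proof -
  define f where "f = beta_ML_integrand \<alpha> \<beta> \<gamma> p b (c - b)"
  define B where "B = beta_integral b (c - b)"
  define m where "m n = integral {0..1} (\<lambda>t. of_real t ^ n * f t)" for n
  obtain C where int: "\<And>n. (\<lambda>t. of_real t ^ n * f t) integrable_on {0..1}"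
    and C: "\<And>n. norm (m n) \<le> C"
    using bounded_moments[OF assms(5)] unfolding f_def m_def by blast
  have left: "beta_ML \<alpha> \<beta> \<gamma> p (b + of_nat n) (c - b) / B = m n / B" for n
    by (simp add: beta_ML_def beta_ML_integrand_add_of_nat_left[abs_def] m_def f_def)
  have right: "beta_ML \<alpha> \<beta> \<gamma> p (c - b + of_nat n) (c - (c - b)) / beta_integral (c - b) (c - (c - b)) =
      (\<Sum>k\<le>n. of_nat (n choose k) * (-1) ^ k * (m k / B))" for n
  proof -
    have "beta_ML \<alpha> \<beta> \<gamma> p (c - b + of_nat n) (c - (c - b)) =
        integral {0..1} (\<lambda>t. of_real (1 - t) ^ n * f t)"
      \<comment> \<open>Commuting moves the shift by \<open>n\<close> to the second argument, where
        it becomes the factor \<open>(1 - t) ^ n\<close> on the same \<open>f\<close>.\<close>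
      by (subst beta_ML_commute) (simp add: beta_ML_def beta_ML_integrand_add_of_nat_right[abs_def] f_def)
    then show ?thesis
      using integral_binomial_moment[OF int, of n] beta_integral_commute[of "c - b" b]
      by (simp add: m_def B_def sum_divide_distrib)
  qed
  \<comment> \<open>Division by zero yields 0, so the bound holds for any value of
    \<open>B\<close>.\<close>
  have "norm (m n / B) \<le> C / norm B" for n
    using C by (simp add: norm_divide divide_right_mono)
  from egf_binomial_transform[OF this] show ?thesis
    unfolding Phi_ML_def right left[unfolded B_def] B_def .
qed

end
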